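(* Let $(\mathcal{C},\lambda)$ be a $(2n+1)$-dimensional contact manifold with canonical coordinates $(x,p,z)$, $\lambda=dz-p_a\,dx^a$, and let $\varphi$ be a strictly convex function of $p$ only such that the Legendre submanifold generated by $-\varphi$ is simply connected. Let $x'=\{x'^1,\dots,x'^n\}$ and $x''=\{x''^1,\dots,x''^n\}$ be constants, and let $\{g_{ab}(p)\}$ be the metric components $g_{ab}=\partial^2\psi/\partial x^a\partial x^b$ with the arguments written in terms of $p$, where $\psi$ is the function of $x$ related to $\varphi$ by the total Legendre transform. Set $$F_a(p)=g_{aj}(p)\,(x''^j-x'^j),\qquad a\in\{1,\dots,n\}.$$ Then the restricted contact Hamiltonian vector field $X_h|_{h=0}$ associated to $$h(x,p,z)=\Big(x^a-\frac{\partial\varphi}{\partial p_a}(p)\Big)F_a(p)+\Gamma\big(x^jp_j-\varphi(p)-z\big),$$ where $\Gamma$ is a function of one variable with $\Gamma(0)=0$ and $\Gamma(s)\neq0$ for $s\neq0$, gives the $\nabla$-geodesic curve connecting the two points whose $\nabla$-affine coordinates are $x'$ and $x''$.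
   Context: All objects are smooth, repeated indices are summed over $1,\dots,n$, and everything is expressed in the canonical coordinates. For a function $h$ on $\mathcal{C}$, the contact Hamiltonian vector field $X_h$ is defined by $\iota_{X_h}\lambda=h$, $\iota_{X_h}d\lambda=-(dh-(\mathcal{R}h)\lambda)$ with $\mathcal{R}=\partial/\partial z$; in coordinates $\dot x^a=-\partial h/\partial p_a$, $\dot p_a=\partial h/\partial x^a+p_a\,\partial h/\partial z$, $\dot z=h-p_a\,\partial h/\partial p_a$. The embedded Legendre submanifold generated by $-\varphi$ is $\mathcal{A}_\varphi^{\mathcal{C}}=\{(x,p,z): x^a=\partial\varphi/\partial p_a,\ z=p_i\,\partial\varphi/\partial p_i-\varphi(p)\}$. The restricted contact Hamiltonian vector field $X_h|_{h=0}$ is the restriction of $X_h$ to $h=0$, taken as the vector field on $\mathcal{A}_\varphi^{\mathcal{C}}$ with components $\dot x^a=\frac{d}{dt}(\partial\varphi/\partial p_a)$, $\dot p_a=F_a(p)$, $\dot z=p_jF_k\,\partial^2\varphi/\partial p_k\partial p_j$. The functions $\psi$ and $\varphi$ are related by $\varphi(p)=\sup_x[x^ap_a-\psi(x)]$, with $x^a=\partial\varphi/\partial p_a$ and $p_a=\partial\psi/\partial x^a$. $\mathcal{A}_\varphi^{\mathcal{C}}$ carries the following dually flat structure: the Riemannian metric $g=g_{ab}\,dx^a\otimes dx^b=g^{ab}\,dp_a\otimes dp_b$ with $g^{ab}=\partial^2\varphi/\partial p_a\partial p_b$ and $g_{aj}g^{jb}=\delta_a^b$; the flat connection $\nabla$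 whose connection coefficients vanish in the coordinates $x$ (so $x$ are $\nabla$-affine coordinates); and the dual connection $\nabla^*$, determined by $Z[g(X,Y)]=g(\nabla_ZX,Y)+g(X,\nabla^*_ZY)$ for all vector fields $X,Y,Z$, whose connection coefficients vanish in the coordinates $p$ (so $p$ are $\nabla^*$-affine coordinates). *)

theory Defs
  imports "HOL-Analysis.Analysis"
begin

section \<open>Calculus in coordinates\<close>

primrec Ck_on :: "nat \<Rightarrow> 'a::real_normed_vector set \<Rightarrow> ('a \<Rightarrow> 'b::real_normed_vector) \<Rightarrow> bool" where
  "Ck_on 0 S f \<longleftrightarrow> continuous_on S f"
| "Ck_on (Suc k) S f \<longleftrightarrow>
     f differentiable_on S \<and> (\<forall>v. Ck_on k S (\<lambda>x. frechet_derivative f (at x) v))"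

text \<open>Intended for open \<open>S\<close> only, since the derivatives are the unrestricted ones.\<close>

definition smooth_on :: "'a::real_normed_vector set \<Rightarrow> ('a \<Rightarrow> 'b::real_normed_vector) \<Rightarrow> bool" where
  "smooth_on S f \<longleftrightarrow> (\<forall>k. Ck_on k S f)"

definition partial :: "'n::finite \<Rightarrow> (real^'n \<Rightarrow> real) \<Rightarrow> real^'n \<Rightarrow> real" where
  "partial i f x = frechet_derivative f (at x) (axis i 1)"

definition grad :: "(real^'n::finite \<Rightarrow> real) \<Rightarrow> real^'n \<Rightarrow> real^'n" where
  "grad f x = (\<chi> i. partial i f x)"

definition hess :: "(real^'n::finite \<Rightarrow> real) \<Rightarrow> real^'n \<Rightarrow> real^'n^'n" where
  "hess f x = (\<chi> i j. partial i (partial j f) x)"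

text \<open>On a convex set this is the usual notion; on other sets the inequality is required along
  every segment contained in the set.\<close>

definition strictly_convex_on :: "'a::real_vector set \<Rightarrow> ('a \<Rightarrow> real) \<Rightarrow> bool" where
  "strictly_convex_on S f \<longleftrightarrow>
     (\<forall>x\<in>S. \<forall>y\<in>S. x \<noteq> y \<longrightarrow> closed_segment x y \<subseteq> S \<longrightarrow>
        (\<forall>t. 0 < t \<and> t < 1 \<longrightarrow>
           f ((1 - t) *\<^sub>R x + t *\<^sub>R y) < (1 - t) * f x + t * f y))"


section \<open>Contact geometry in canonical coordinates\<close>

text \<open>Points \<open>(x, p, z)\<close>; tangent vectors \<open>(vx, vp, vz)\<close> have the same type.\<close>

type_synonym 'n contact = "(real^'n) \<times> (real^'n) \<times> real"

fun contact_form :: "'n::finite contact \<Rightarrow> 'n contact \<Rightarrow> real" where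
  "contact_form (x, p, z) (vx, vp, vz) = vz - (\<Sum>a\<in>UNIV. p $ a * vx $ a)"

definition reeb :: "'n::finite contact" where
  "reeb = (0, 0, 1)"

text \<open>\<open>(d\<alpha>)(u, v) = u(\<alpha>(v)) - v(\<alpha>(u)) - \<alpha>([u, v])\<close> evaluated on constant fields \<open>u\<close>, \<open>v\<close>,
  whose bracket vanishes.\<close>

definition ext_deriv :: "('a::real_normed_vector \<Rightarrow> 'a \<Rightarrow> real) \<Rightarrow> 'a \<Rightarrow> 'a \<Rightarrow> 'a \<Rightarrow> real" where
  "ext_deriv \<alpha> q u v =
     frechet_derivative (\<lambda>y. \<alpha> y v) (at q) u - frechet_derivative (\<lambda>y. \<alpha> y u) (at q) v"

definition is_contact_hamiltonian_vector ::
  "('n::finite contact \<Rightarrow> real) \<Rightarrow> 'n contact \<Rightarrow> 'n contact \<Rightarrow> bool" where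
  "is_contact_hamiltonian_vector h q v \<longleftrightarrow>
     contact_form q v = h q \<and>
     (\<forall>w. ext_deriv contact_form q v w =
        - (frechet_derivative h (at q) w - frechet_derivative h (at q) reeb * contact_form q w))"

definition contact_hamiltonian_vf :: "('n::finite contact \<Rightarrow> real) \<Rightarrow> 'n contact \<Rightarrow> 'n contact" where
  "contact_hamiltonian_vf h q = (THE v. is_contact_hamiltonian_vector h q v)"

lemma ext_deriv_contact_form:
  "ext_deriv contact_form (x, p, z) (ux, up, uz) (vx, vp, vz) = ux \<bullet> vp - up \<bullet> vx"
proof -
  have *: "frechet_derivative (\<lambda>y. contact_form y (vx, vp, vz)) (at q) =
      (\<lambda>u. - (fst (snd u) \<bullet> vx))" for q :: "'a contact" and vx vp :: "real^'a" and vz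
  proof -
    have "(\<lambda>y. contact_form y (vx, vp, vz)) = (\<lambda>y. vz - fst (snd y) \<bullet> vx)"
      by (auto simp: fun_eq_iff inner_vec_def)
    moreover have "((\<lambda>y :: 'a contact. vz - fst (snd y) \<bullet> vx) has_derivative
        (\<lambda>u. - (fst (snd u) \<bullet> vx))) (at q)"
      by (auto intro!: derivative_eq_intros)
    ultimately show ?thesis
      using frechet_derivative_at by metis
  qed
  show ?thesis
    by (simp add: ext_deriv_def * inner_commute)
qed

text \<open>The defining equations have a unique solution, with the familiar components.\<close>

lemma contact_hamiltonian_vf_components:
  fixes h :: "'n::finite contact \<Rightarrow> real" and x p :: "real^'n" and z :: real
  assumes "h differentiable (at (x, p, z))"
  defines "D \<equiv> frechet_derivative h (at (x, p, z))"
  defines "v \<equiv> (\<chi> a. - D (0, axis a 1, 0),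
                 \<chi> a. D (axis a 1, 0, 0) + p $ a * D (0, 0, 1),
                 h (x, p, z) - (\<Sum>a\<in>UNIV. p $ a * D (0, axis a 1, 0)))"
  shows "is_contact_hamiltonian_vector h (x, p, z) w \<longleftrightarrow> w = v"
    and "contact_hamiltonian_vf h (x, p, z) = v"
proof -
  have lin: "linear D"
    using assms by (simp add: linear_frechet_derivative)
  define A where "A = (\<chi> a. D (axis a 1, 0, 0))"
  define B where "B = (\<chi> a. D (0, axis a 1, 0))"
  define c where "c = D (0, 0, 1)"
  have expand: "f u = (\<chi> a. f (axis a 1)) \<bullet> u" if "linear f" for f :: "real^'n \<Rightarrow> real" and u
  proof -
    have "f u = f (\<Sum>a\<in>UNIV. u $ a *\<^sub>R axis a 1)"
      using basis_expansion[of u] by (simp add: scalar_mult_eq_scaleR)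
    also have "\<dots> = (\<chi> a. f (axis a 1)) \<bullet> u"
      by (simp add: linear_sum[OF that] linear_scale[OF that] inner_vec_def mult.commute)
    finally show ?thesis .
  qed
  have "linear (\<lambda>u. D (u, 0, 0))"
    using linear_add[OF lin, of "(_, 0, 0)" "(_, 0, 0)"] linear_scale[OF lin, of _ "(_, 0, 0)"]
    by (intro linearI) simp_all
  moreover have "linear (\<lambda>u. D (0, u, 0))"
    using linear_add[OF lin, of "(0, _, 0)" "(0, _, 0)"] linear_scale[OF lin, of _ "(0, _, 0)"]
    by (intro linearI) simp_all
  ultimately have lins: "linear (\<lambda>u. D (u, 0, 0))" "linear (\<lambda>u. D (0, u, 0))"
    by blast+
  have Dx: "D (u, 0, 0) = A \<bullet> u" for u
    unfolding A_def by (rule expand[OF lins(1)])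
  have Dp: "D (0, u, 0) = B \<bullet> u" for u
    unfolding B_def by (rule expand[OF lins(2)])
  have Dz: "D (0, 0, s) = s * c" for s
    using linear_scale[OF lin, of s "(0, 0, 1)"] by (simp add: c_def)
  have D: "D (u, w, s) = A \<bullet> u + B \<bullet> w + s * c" for u w s
  proof -
    have "(u, w, s) = (u, 0, 0) + ((0, w, 0) + (0, 0, s))" by simp
    then show ?thesis by (simp only: linear_add[OF lin] Dx Dp Dz add.assoc)
  qed
  have v: "v = (- B, A + c *\<^sub>R p, h (x, p, z) - p \<bullet> B)"
    by (auto simp: v_def A_def B_def c_def vec_eq_iff inner_vec_def)
  have char: "is_contact_hamiltonian_vector h (x, p, z) w \<longleftrightarrow> w = v" for w
  proof (cases w)
    case (fields wx wp wz)
    have eq: "is_contact_hamiltonian_vector h (x, p, z) w \<longleftrightarrow>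
        wz - p \<bullet> wx = h (x, p, z) \<and>
        (\<forall>ux up uz. wx \<bullet> up - wp \<bullet> ux = - (A \<bullet> ux + B \<bullet> up + uz * c - c * (uz - p \<bullet> ux)))"
      by (simp add: is_contact_hamiltonian_vector_def fields split_paired_All
          ext_deriv_contact_form reeb_def D_def[symmetric] D inner_vec_def)
    show ?thesis
    proof
      assume "is_contact_hamiltonian_vector h (x, p, z) w"
      then have 1: "wz - p \<bullet> wx = h (x, p, z)"
        and 2: "wx \<bullet> up - wp \<bullet> ux = - (A \<bullet> ux + B \<bullet> up + uz * c - c * (uz - p \<bullet> ux))"
        for ux up uz
        using eq by blast+
      have "(wx + B) \<bullet> (wx + B) = 0"
        using 2[of "wx + B" 0 0] by (simp add: inner_add_left)
      then have wx: "wx = - B" by (simp only: inner_eq_zero_iff add_eq_0_iff2)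
      have "(wp - (A + c *\<^sub>R p)) \<bullet> (wp - (A + c *\<^sub>R p)) = 0"
        using 2[of 0 "wp - (A + c *\<^sub>R p)" 0] by (simp add: inner_add_left inner_diff_left)
      then have wp: "wp = A + c *\<^sub>R p" by simp
      show "w = v" using 1 wx wp by (simp add: fields v)
    next
      assume "w = v"
      then show "is_contact_hamiltonian_vector h (x, p, z) w"
        unfolding eq by (simp add: fields v inner_add_left algebra_simps)
    qed
  qed
  show "is_contact_hamiltonian_vector h (x, p, z) w \<longleftrightarrow> w = v"
    by (rule char)
  show "contact_hamiltonian_vf h (x, p, z) = v"
    by (simp add: contact_hamiltonian_vf_def char)
qed

definition legendre_point :: "(real^'n::finite \<Rightarrow> real) \<Rightarrow> real^'n \<Rightarrow> 'n contact" where
  "legendre_point \<phi> p = (grad \<phi> p, p, (\<Sum>i\<in>UNIV. p $ i * partial i \<phi> p) - \<phi> p)"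

text \<open>The embedded Legendre submanifold generated by \<open>-\<phi>\<close>, where \<open>P\<close> is the domain of \<open>\<phi>\<close>.\<close>

definition legendre_submanifold :: "(real^'n::finite) set \<Rightarrow> (real^'n \<Rightarrow> real) \<Rightarrow> 'n contact set" where
  "legendre_submanifold P \<phi> =
     {(x, p, z). p \<in> P \<and> (\<forall>a. x $ a = partial a \<phi> p) \<and>
                 z = (\<Sum>i\<in>UNIV. p $ i * partial i \<phi> p) - \<phi> p}"

lemma legendre_submanifold_eq_image: "legendre_submanifold P \<phi> = legendre_point \<phi> ` P"
  by (auto simp: legendre_submanifold_def legendre_point_def grad_def vec_eq_iff)

definition integral_curve_on ::
  "real set \<Rightarrow> 'a::real_normed_vector set \<Rightarrow> ('a \<Rightarrow> 'a) \<Rightarrow> (real \<Rightarrow> 'a) \<Rightarrow> bool" where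
  "integral_curve_on I M V \<gamma> \<longleftrightarrow>
     (\<forall>t\<in>I. \<gamma> t \<in> M \<and> (\<gamma> has_vector_derivative V (\<gamma> t)) (at t within I))"


section \<open>Total Legendre transform\<close>

text \<open>\<open>X\<close> is the domain of \<open>\<psi>\<close>, that is, the range of the coordinates \<open>x\<close> on the Legendre
  submanifold.\<close>

definition total_legendre_pair ::
  "(real^'n::finite) set \<Rightarrow> (real^'n) set \<Rightarrow> (real^'n \<Rightarrow> real) \<Rightarrow> (real^'n \<Rightarrow> real) \<Rightarrow> bool" where
  "total_legendre_pair P X \<phi> \<psi> \<longleftrightarrow>
     (\<forall>p\<in>P. bdd_above ((\<lambda>x. x \<bullet> p - \<psi> x) ` X) \<and> \<phi> p = (SUP x\<in>X. x \<bullet> p - \<psi> x)) \<and>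
     grad \<phi> ` P = X \<and> (\<forall>p\<in>P. grad \<psi> (grad \<phi> p) = p)"


section \<open>The dually flat structure\<close>

text \<open>Tensors, vector fields and connections on the Legendre submanifold are written in the global
  coordinates \<open>x\<close>. The vector \<open>K x a b\<close> has the components of \<open>\<nabla>\<^bsub>\<partial>\<^sub>a\<^esub> \<partial>\<^sub>b\<close>, that is, the
  connection coefficients with lower indices \<open>a\<close>, \<open>b\<close>.\<close>

type_synonym 'n conn = "real^'n \<Rightarrow> 'n \<Rightarrow> 'n \<Rightarrow> real^'n"

definition cov_deriv ::
  "'n::finite conn \<Rightarrow> (real^'n \<Rightarrow> real^'n) \<Rightarrow> (real^'n \<Rightarrow> real^'n) \<Rightarrow> real^'n \<Rightarrow> real^'n" where
  "cov_deriv K Z Y x =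
     frechet_derivative Y (at x) (Z x) + (\<Sum>a\<in>UNIV. \<Sum>b\<in>UNIV. (Z x $ a * Y x $ b) *\<^sub>R K x a b)"

definition metric_apply :: "(real^'n::finite \<Rightarrow> real^'n^'n) \<Rightarrow> real^'n \<Rightarrow> real^'n \<Rightarrow> real^'n \<Rightarrow> real" where
  "metric_apply g x u v = (\<Sum>a\<in>UNIV. \<Sum>b\<in>UNIV. g x $ a $ b * u $ a * v $ b)"

definition riemannian_metric_on :: "(real^'n::finite) set \<Rightarrow> (real^'n \<Rightarrow> real^'n^'n) \<Rightarrow> bool" where
  "riemannian_metric_on X g \<longleftrightarrow>
     smooth_on X g \<and>
     (\<forall>x\<in>X. (\<forall>u v. metric_apply g x u v = metric_apply g x v u) \<and>
             (\<forall>u. u \<noteq> 0 \<longrightarrow> metric_apply g x u u > 0))"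

definition dual_connections ::
  "(real^'n::finite) set \<Rightarrow> (real^'n \<Rightarrow> real^'n^'n) \<Rightarrow> 'n conn \<Rightarrow> 'n conn \<Rightarrow> bool" where
  "dual_connections X g K K' \<longleftrightarrow>
     (\<forall>U V Z. smooth_on X U \<longrightarrow> smooth_on X V \<longrightarrow> smooth_on X Z \<longrightarrow>
        (\<forall>x\<in>X. frechet_derivative (\<lambda>y. metric_apply g y (U y) (V y)) (at x) (Z x) =
           metric_apply g x (cov_deriv K Z U x) (V x) + metric_apply g x (U x) (cov_deriv K' Z V x)))"

text \<open>The coordinate field \<open>\<partial>/\<partial>p\<^sub>a\<close> in the coordinates \<open>x\<close>: its components are
  \<open>\<partial>x\<^sup>b/\<partial>p\<^sub>a\<close> with \<open>x = grad \<phi> p\<close>, taken at \<open>p = grad \<psi> x\<close>.\<close>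

definition p_coord_field ::
  "(real^'n::finite \<Rightarrow> real) \<Rightarrow> (real^'n \<Rightarrow> real) \<Rightarrow> 'n \<Rightarrow> real^'n \<Rightarrow> real^'n" where
  "p_coord_field \<phi> \<psi> a x = (\<chi> b. partial a (partial b \<phi>) (grad \<psi> x))"

text \<open>The coefficients of a connection in given coordinates vanish iff the covariant derivatives of
  the coordinate fields along each other do; this is how the last clause refers to the
  coordinates \<open>p\<close>.\<close>

definition dually_flat_structure ::
  "(real^'n::finite) set \<Rightarrow> (real^'n) set \<Rightarrow> (real^'n \<Rightarrow> real) \<Rightarrow> (real^'n \<Rightarrow> real) \<Rightarrow>
   (real^'n \<Rightarrow> real^'n^'n) \<Rightarrow> 'n conn \<Rightarrow> 'n conn \<Rightarrow> bool" where
  "dually_flat_structure P X \<phi> \<psi> g nabla nabla_star \<longleftrightarrow>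
     riemannian_metric_on X g \<and>
     (\<forall>x\<in>X. g x = hess \<psi> x) \<and>
     (\<forall>p\<in>P. g (grad \<phi> p) ** hess \<phi> p = mat 1) \<and>
     (\<forall>x\<in>X. \<forall>a b. nabla x a b = 0) \<and>
     dual_connections X g nabla nabla_star \<and>
     (\<forall>x\<in>X. \<forall>a b. cov_deriv nabla_star (p_coord_field \<phi> \<psi> a) (p_coord_field \<phi> \<psi> b) x = 0)"

text \<open>A curve in \<open>M\<close>, read in the coordinates \<open>x\<close> (its first component), that satisfies the
  geodesic equation of \<open>K\<close>.\<close>

definition geodesic_on ::
  "real set \<Rightarrow> 'n::finite contact set \<Rightarrow> 'n conn \<Rightarrow> (real \<Rightarrow> 'n contact) \<Rightarrow> bool" where
  "geodesic_on I M K \<gamma> \<longleftrightarrow>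
     (\<forall>t\<in>I. \<gamma> t \<in> M) \<and>
     (\<exists>v w. \<forall>t\<in>I.
        ((\<lambda>s. fst (\<gamma> s)) has_vector_derivative v t) (at t within I) \<and>
        (v has_vector_derivative w t) (at t within I) \<and>
        w t + (\<Sum>a\<in>UNIV. \<Sum>b\<in>UNIV. (v t $ a * v t $ b) *\<^sub>R K (fst (\<gamma> t)) a b) = 0)"

end

theory Submission
  imports Defs
begin

text \<open>Along the Legendre submanifold the \<open>x\<close>-component of \<open>X\<^sub>h\<close> is \<open>(hess \<phi>) F\<close>, and since \<open>hess \<phi>\<close> is
  the inverse of \<open>g\<close>, it is the constant vector \<open>x'' - x'\<close>: integral curves are straight segments
  in the affine coordinates \<open>x\<close>. Conversely, a straight segment in \<open>x\<close> lifts uniquely to the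
  submanifold through \<open>p = grad \<psi> x\<close>, and the lift moves with the components of \<open>X\<^sub>h\<close> because
  \<open>hess \<psi> = g\<close>.\<close>

section \<open>Derivatives of smooth functions, gradients and Hessians\<close>

lemma smooth_on_imp_differentiable:
  assumes "smooth_on S f" "open S" "x \<in> S"
  shows "f differentiable (at x)"
proof -
  have "Ck_on (Suc 0) S f"
    using assms(1) unfolding smooth_on_def by blast
  then show ?thesis
    using assms(2,3) by (simp add: differentiable_on_eq_differentiable_at)
qed

lemma smooth_on_partial:
  assumes "smooth_on S f"
  shows "smooth_on S (partial i f)"
  unfolding smooth_on_def
proof
  fix k
  have "Ck_on (Suc k) S f"
    using assms unfolding smooth_on_def by blast
  then have "Ck_on k S (\<lambda>x. frechet_derivative f (at x) (axis i 1))"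
    by simp
  then show "Ck_on k S (partial i f)"
    by (simp add: partial_def[abs_def])
qed

lemma has_derivative_inner_grad:
  fixes f :: "real^'n::finite \<Rightarrow> real"
  assumes "f differentiable (at x)"
  shows "(f has_derivative (\<lambda>u. grad f x \<bullet> u)) (at x)"
proof -
  let ?D = "frechet_derivative f (at x)"
  have lin: "linear ?D"
    using assms by (rule linear_frechet_derivative)
  have "?D u = grad f x \<bullet> u" for u
  proof -
    have "?D u = ?D (\<Sum>a\<in>UNIV. u $ a *\<^sub>R axis a 1)"
      using basis_expansion[of u] by (simp add: scalar_mult_eq_scaleR)
    also have "\<dots> = grad f x \<bullet> u"
      by (simp add: linear_sum[OF lin] linear_scale[OF lin] inner_vec_def grad_def partial_def
          mult.commute)
    finally show ?thesis .
  qed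
  then have "?D = (\<lambda>u. grad f x \<bullet> u)" by blast
  then show ?thesis
    using assms frechet_derivative_works by metis
qed

text \<open>The first index of \<open>hess f x\<close> is the direction of differentiation, the
  second the component of the gradient. The increment \<open>u\<close> is contracted with the first,
  so it acts as a row vector from the left.\<close>

lemma has_derivative_grad:
  fixes f :: "real^'n::finite \<Rightarrow> real"
  assumes "smooth_on S f" "open S" "x \<in> S"
  shows "(grad f has_derivative (\<lambda>u. u v* hess f x)) (at x)"
proof -
  have "((\<lambda>y. grad f y $ i) has_derivative (\<lambda>u. (u v* hess f x) $ i)) (at x)" for i
  proof -
    have "partial i f differentiable (at x)"
      using smooth_on_imp_differentiable smooth_on_partial assms by metis
    from has_derivative_inner_grad[OF this] show ?thesis
      by (simp add: grad_def hess_def vector_matrix_mult_def inner_vec_def mult.commute)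
  qed
  then show ?thesis
    by (auto simp: has_derivative_componentwise_within[of "grad f"] Basis_vec_def inner_axis)
qed

section \<open>Symmetry of the metric matrix and of its inverse\<close>

lemma metric_apply_eq_inner: "metric_apply g x u v = u \<bullet> (g x *v v)"
  by (simp add: metric_apply_def inner_vec_def matrix_vector_mult_def sum_distrib_left
      mult.assoc mult.left_commute)

lemma riemannian_metric_on_symmetric:
  assumes "riemannian_metric_on X g" "x \<in> X"
  shows "transpose (g x) = g x"
proof -
  have "axis a 1 \<bullet> (g x *v axis b 1) = axis b 1 \<bullet> (g x *v axis a 1)" for a b
    using assms metric_apply_eq_inner[of g x] unfolding riemannian_metric_on_def by metis
  then show ?thesis
    by (simp add: vec_eq_iff transpose_def inner_axis' matrix_vector_mul_component)
       (simp add: inner_axis)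
qed

text \<open>Transposing \<open>A ** B = mat 1\<close> makes \<open>transpose B\<close> a left
  inverse of \<open>A\<close>, and a left inverse equals a right inverse. This carries symmetry from
  the metric over to \<open>hess \<phi>\<close>.\<close>

lemma symmetric_right_inverse:
  fixes A B :: "real^'n::finite^'n"
  assumes "transpose A = A" "A ** B = mat 1"
  shows "transpose B = B"
proof -
  have BA: "transpose B ** A = mat 1"
    using assms by (metis matrix_transpose_mul transpose_mat)
  then have "transpose B = transpose B ** (A ** B)"
    by (simp add: assms)
  also have "\<dots> = B"
    by (simp add: matrix_mul_assoc BA)
  finally show ?thesis .
qed

text \<open>On the submanifold both \<open>x - grad \<phi> p\<close> and the argument of
  \<open>\<Gamma>\<close> vanish, so \<open>h\<close> is zero there and no derivative of
  \<open>F\<close> enters. With \<open>c\<close> the derivative of \<open>\<Gamma>\<close> at 0, the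
  \<open>\<Gamma>\<close> term adds \<open>c\<close> times \<open>p\<close> to the
  \<open>x\<close>-gradient of \<open>h\<close> and \<open>- c\<close> to its
  \<open>z\<close>-derivative; these cancel in the momentum equation.\<close>

lemma contact_hamiltonian_vf_on_legendre:
  fixes \<phi> :: "real^'n::finite \<Rightarrow> real" and F :: "real^'n \<Rightarrow> real^'n"
  assumes "open C" "open P" "p \<in> P" "legendre_point \<phi> p \<in> C"
    and smooth: "smooth_on P \<phi>"
    and F: "F differentiable (at p)" and \<Gamma>: "\<Gamma> differentiable (at 0)" "\<Gamma> 0 = 0"
    and h: "\<And>x p z. (x, p, z) \<in> C \<Longrightarrow>
      h (x, p, z) = (x - grad \<phi> p) \<bullet> F p + \<Gamma> (x \<bullet> p - \<phi> p - z)"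
  shows "contact_hamiltonian_vf h (legendre_point \<phi> p) =
    (hess \<phi> p *v F p, F p, p \<bullet> (hess \<phi> p *v F p))"
proof -
  let ?x = "grad \<phi> p" and ?z = "grad \<phi> p \<bullet> p - \<phi> p"
  have pt: "legendre_point \<phi> p = (?x, p, ?z)"
    by (simp add: legendre_point_def grad_def inner_vec_def mult.commute)
  \<comment> \<open>The formula for \<open>h\<close> is given on \<open>C\<close> only. It is
    differentiated on the whole space, and the result passes to \<open>h\<close> because
    \<open>C\<close> is open.\<close>
  define h0 where "h0 = (\<lambda>q :: 'n contact. (fst q - grad \<phi> (fst (snd q))) \<bullet> F (fst (snd q))
    + \<Gamma> (fst q \<bullet> fst (snd q) - \<phi> (fst (snd q)) - snd (snd q)))"
  have h0: "h q = h0 q" if "q \<in> C" for q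
    using h that by (cases q) (auto simp: h0_def)
  obtain F' where F': "(F has_derivative F') (at p)"
    using F unfolding differentiable_def by blast
  obtain c where c: "(\<Gamma> has_derivative (\<lambda>s. c * s)) (at 0)"
    using \<Gamma>(1) by (auto simp: real_differentiable_def has_field_derivative_def)
  let ?q = "(?x, p, ?z)"
  let ?D = "\<lambda>v :: 'n contact. (fst v - fst (snd v) v* hess \<phi> p) \<bullet> F p
    + c * (fst v \<bullet> p - snd (snd v))"
  have p: "((\<lambda>q :: 'n contact. fst (snd q)) has_derivative (\<lambda>v. fst (snd v))) (at ?q)"
    by (auto intro!: derivative_eq_intros)
  have grad: "((\<lambda>q. grad \<phi> (fst (snd q))) has_derivative (\<lambda>v. fst (snd v) v* hess \<phi> p)) (at ?q)"
    using has_derivative_compose[OF p, of "grad \<phi>"] has_derivative_grad[OF smooth assms(2,3)]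
    by simp
  have phi: "((\<lambda>q. \<phi> (fst (snd q))) has_derivative (\<lambda>v. ?x \<bullet> fst (snd v))) (at ?q)"
    using has_derivative_compose[OF p, of \<phi>]
      has_derivative_inner_grad[OF smooth_on_imp_differentiable[OF smooth assms(2,3)]]
    by simp
  have Fd: "((\<lambda>q. F (fst (snd q))) has_derivative (\<lambda>v. F' (fst (snd v)))) (at ?q)"
    using has_derivative_compose[OF p, of F] F' by simp
  \<comment> \<open>At the base point \<open>x = grad \<phi> p\<close>, so the momentum increments
    of \<open>x \<bullet> p\<close> and of \<open>\<phi> p\<close> cancel.\<close>
  have s: "((\<lambda>q. fst q \<bullet> fst (snd q) - \<phi> (fst (snd q)) - snd (snd q)) has_derivative
      (\<lambda>v. fst v \<bullet> p - snd (snd v))) (at ?q)"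
    by (rule derivative_eq_intros phi p refl)+
       (auto simp: fun_eq_iff inner_commute)
  have "((\<lambda>q. \<Gamma> (fst q \<bullet> fst (snd q) - \<phi> (fst (snd q)) - snd (snd q))) has_derivative
      (\<lambda>v. c * (fst v \<bullet> p - snd (snd v)))) (at ?q)"
    using has_derivative_compose[OF s, of \<Gamma>] c by simp
  \<comment> \<open>The product rule pairs \<open>F'\<close> with
    \<open>grad \<phi> p - grad \<phi> p\<close>, which removes it.\<close>
  moreover have "((\<lambda>q. (fst q - grad \<phi> (fst (snd q))) \<bullet> F (fst (snd q))) has_derivative
      (\<lambda>v. (fst v - fst (snd v) v* hess \<phi> p) \<bullet> F p)) (at ?q)"
    by (rule derivative_eq_intros grad Fd refl)+ simp
  ultimately have "(h0 has_derivative ?D) (at ?q)"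
    unfolding h0_def by (rule has_derivative_add[rotated])
  then have D: "(h has_derivative ?D) (at ?q)"
    by (rule has_derivative_transform_within_open[OF _ \<open>open C\<close>])
      (use assms(4) h0 in \<open>simp_all add: pt\<close>)
  then have fr: "frechet_derivative h (at ?q) = ?D"
    by (rule frechet_derivative_at[symmetric])
  have h_zero: "h ?q = 0"
    using h[of ?x p ?z] assms(4) \<Gamma>(2) by (simp add: pt)
  have D_p: "?D (0, axis a 1, 0) = - (hess \<phi> p *v F p) $ a" for a
    by (simp add: dot_lmul_matrix inner_axis')
  have D_x: "?D (axis a 1, 0, 0) = F p $ a + c * p $ a" for a
    by (simp add: inner_axis')
  have D_z: "?D (0, 0, 1) = - c"
    by simp
  have "h differentiable (at ?q)"
    using D unfolding differentiable_def by blast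
  from contact_hamiltonian_vf_components(2)[OF this] show ?thesis
    unfolding pt fr D_p D_x D_z h_zero
    by (simp add: inner_vec_def[of p] vec_eq_iff sum_negf)
qed

text \<open>A curve whose \<open>x\<close>-part starts at \<open>x'\<close> with constant velocity
  \<open>x'' - x'\<close> reaches \<open>x''\<close> exactly at time 1; hence the unit time
  interval. The range \<open>X\<close> may fail to contain the segment between the two points, so
  the last clause states when the curve exists.\<close>

theorem theorem3p2:
  fixes C :: "'n::finite contact set"
    and P X :: "(real^'n) set"
    and \<phi> \<psi> :: "real^'n \<Rightarrow> real"
    and g :: "real^'n \<Rightarrow> real^'n^'n"
    and nabla nabla_star :: "'n conn"
    and x' x'' :: "real^'n"
    and F :: "real^'n \<Rightarrow> real^'n"
    and \<Gamma> :: "real \<Rightarrow> real"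
    and h :: "'n contact \<Rightarrow> real"
  assumes "open C" and "open P" and "open X"
    and "\<forall>(x, p, z)\<in>C. p \<in> P"
    and "legendre_submanifold P \<phi> \<subseteq> C"
    and "smooth_on P \<phi>" and "strictly_convex_on P \<phi>"
    and "simply_connected (legendre_submanifold P \<phi>)"
    and "smooth_on X \<psi>" and "total_legendre_pair P X \<phi> \<psi>"
    and "dually_flat_structure P X \<phi> \<psi> g nabla nabla_star"
    and "\<forall>p\<in>P. \<forall>a. F p $ a = (\<Sum>j\<in>UNIV. g (grad \<phi> p) $ a $ j * (x'' $ j - x' $ j))"
    and "smooth_on UNIV \<Gamma>" and "\<Gamma> 0 = 0" and "\<forall>s. s \<noteq> 0 \<longrightarrow> \<Gamma> s \<noteq> 0"
    and "\<forall>(x, p, z)\<in>C. h (x, p, z) =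
           (\<Sum>a\<in>UNIV. (x $ a - partial a \<phi> p) * F p $ a)
           + \<Gamma> ((\<Sum>j\<in>UNIV. x $ j * p $ j) - \<phi> p - z)"
  shows "legendre_submanifold P \<phi> \<subseteq> {q \<in> C. h q = 0}
    \<and> (\<forall>p\<in>P. contact_hamiltonian_vf h (legendre_point \<phi> p) =
         (frechet_derivative (grad \<phi>) (at p) (F p),
          F p,
          \<Sum>j\<in>UNIV. \<Sum>k\<in>UNIV. p $ j * F p $ k * partial k (partial j \<phi>) p))
    \<and> (\<forall>\<gamma>.
         integral_curve_on {0..1} (legendre_submanifold P \<phi> \<inter> {q \<in> C. h q = 0})
           (contact_hamiltonian_vf h) \<gamma> \<and> fst (\<gamma> 0) = x'
         \<longleftrightarrow>
         geodesic_on {0..1} (legendre_submanifold P \<phi>) nabla \<gamma> \<and> fst (\<gamma> 0) = x' \<and> fst (\<gamma> 1) = x'')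
    \<and> ((\<exists>\<gamma>. integral_curve_on {0..1} (legendre_submanifold P \<phi> \<inter> {q \<in> C. h q = 0})
           (contact_hamiltonian_vf h) \<gamma> \<and> fst (\<gamma> 0) = x')
         \<longleftrightarrow> closed_segment x' x'' \<subseteq> X)"
proof -
  let ?M = "legendre_submanifold P \<phi>" and ?d = "x'' - x'"

  \<comment> \<open>The dually flat data and the correspondence between \<open>P\<close> and
    \<open>X\<close>\<close>
  have phi_diff: "\<phi> differentiable (at p)" if "p \<in> P" for p
    using smooth_on_imp_differentiable assms(2,6) that by blast
  have metric: "riemannian_metric_on X g"
    and g_hess: "\<And>x. x \<in> X \<Longrightarrow> g x = hess \<psi> x"
    and g_inv: "\<And>p. p \<in> P \<Longrightarrow> g (grad \<phi> p) ** hess \<phi> p = mat 1"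
    and flat: "\<And>x a b. x \<in> X \<Longrightarrow> nabla x a b = 0"
    using assms(11) unfolding dually_flat_structure_def by blast+
  have X: "grad \<phi> ` P = X" and inv: "\<And>p. p \<in> P \<Longrightarrow> grad \<psi> (grad \<phi> p) = p"
    using assms(10) unfolding total_legendre_pair_def by blast+
  have grad_in: "grad \<phi> p \<in> X" if "p \<in> P" for p
    using X that by blast
  \<comment> \<open>As \<open>X\<close> is the image of \<open>P\<close> under
    \<open>grad \<phi>\<close>, the left inverse \<open>grad \<psi>\<close> is two-sided.\<close>
  have inv': "grad \<psi> x \<in> P" "grad \<phi> (grad \<psi> x) = x" if "x \<in> X" for x
    using X inv that by (metis imageE)+
  have g_sym: "transpose (g x) = g x" if "x \<in> X" for x
    using metric that by (rule riemannian_metric_on_symmetric)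
  have hess_sym: "transpose (hess \<phi> p) = hess \<phi> p" if "p \<in> P" for p
    using g_sym[OF grad_in] g_inv that by (blast intro: symmetric_right_inverse)
  have F: "F p = g (grad \<phi> p) *v ?d" if "p \<in> P" for p
    using assms(12) that by (simp add: vec_eq_iff matrix_vector_mult_def)
  have hess_F: "hess \<phi> p *v F p = ?d" if "p \<in> P" for p
  proof -
    have "hess \<phi> p ** g (grad \<phi> p) = mat 1"
      using g_inv[OF that] matrix_left_right_inverse by blast
    then show ?thesis
      by (simp add: F[OF that] matrix_vector_mul_assoc)
  qed

  \<comment> \<open>The contact Hamiltonian vector field along the submanifold\<close>
  have F_diff: "F differentiable (at p)" if "p \<in> P" for p
  proof -
    \<comment> \<open>On the open set \<open>P\<close>, \<open>F\<close> is \<open>g\<close>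
      composed with \<open>grad \<phi>\<close> and applied to a fixed vector, so it inherits
      differentiability from the smooth metric.\<close>
    have "g differentiable (at (grad \<phi> p))"
      using metric grad_in[OF that] assms(3) smooth_on_imp_differentiable
      unfolding riemannian_metric_on_def by blast
    then obtain g' where g': "(g has_derivative g') (at (grad \<phi> p))"
      unfolding differentiable_def by blast
    have "linear (\<lambda>A :: real^'n^'n. A *v ?d)"
      by (rule linearI)
         (simp_all add: matrix_vector_mult_add_rdistrib scaleR_matrix_vector_assoc)
    then have "((\<lambda>p. g (grad \<phi> p) *v ?d) has_derivative (\<lambda>u. g' (u v* hess \<phi> p) *v ?d)) (at p)"
      using has_derivative_compose[OF has_derivative_grad[OF assms(6,2) that] g']
      by (intro bounded_linear.has_derivative[of "\<lambda>A. A *v ?d"]) (simp_all add: linear_linear)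
    then have "(F has_derivative (\<lambda>u. g' (u v* hess \<phi> p) *v ?d)) (at p)"
      using assms(2) that by (rule has_derivative_transform_within_open) (simp add: F)
    then show ?thesis
      unfolding differentiable_def by blast
  qed
  have \<Gamma>_diff: "\<Gamma> differentiable (at 0)"
    using smooth_on_imp_differentiable assms(13) by blast
  have h: "h (x, p, z) = (x - grad \<phi> p) \<bullet> F p + \<Gamma> (x \<bullet> p - \<phi> p - z)" if "(x, p, z) \<in> C" for x p z
    using assms(16) that by (auto simp: grad_def inner_vec_def)
  have M: "legendre_point \<phi> p \<in> ?M" if "p \<in> P" for p
    using that by (simp add: legendre_submanifold_eq_image)
  have vf: "contact_hamiltonian_vf h (legendre_point \<phi> p) = (?d, F p, p \<bullet> ?d)" if "p \<in> P" for p
    using contact_hamiltonian_vf_on_legendre[where F = F and \<Gamma> = \<Gamma> and h = h,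
        OF assms(1,2) that _ assms(6) F_diff[OF that] \<Gamma>_diff assms(14) h]
      M[OF that] assms(5) hess_F[OF that] by auto
  have sub: "?M \<subseteq> {q \<in> C. h q = 0}"
  proof
    fix q assume q: "q \<in> ?M"
    then obtain p where p: "p \<in> P" "q = legendre_point \<phi> p"
      by (auto simp: legendre_submanifold_eq_image)
    then have "q = (grad \<phi> p, p, grad \<phi> p \<bullet> p - \<phi> p)"
      by (simp add: legendre_point_def grad_def inner_vec_def mult.commute)
    moreover have "q \<in> C"
      using q assms(5) by blast
    ultimately show "q \<in> {q \<in> C. h q = 0}"
      using h assms(14) by auto
  qed
  have components: "contact_hamiltonian_vf h (legendre_point \<phi> p) =
      (frechet_derivative (grad \<phi>) (at p) (F p), F p,
       \<Sum>j\<in>UNIV. \<Sum>k\<in>UNIV. p $ j * F p $ k * partial k (partial j \<phi>) p)" if "p \<in> P" for p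
  proof -
    \<comment> \<open>The claimed components contract \<open>F\<close> with the first Hessian index,
      \<open>hess_F\<close> with the second; symmetry of \<open>hess \<phi>\<close> reconciles
      them.\<close>
    have dF: "F p v* hess \<phi> p = ?d"
      using hess_F[OF that] hess_sym[OF that] by (metis vector_transpose_matrix)
    have "frechet_derivative (grad \<phi>) (at p) (F p) = ?d"
      using has_derivative_grad[OF assms(6,2) that] dF frechet_derivative_at by metis
    moreover have "(\<Sum>j\<in>UNIV. \<Sum>k\<in>UNIV. p $ j * F p $ k * partial k (partial j \<phi>) p) =
        p \<bullet> (F p v* hess \<phi> p)"
      by (simp add: inner_vec_def vector_matrix_mult_def hess_def sum_distrib_left mult.assoc
          mult.left_commute)
    ultimately show ?thesis
      by (simp add: vf[OF that] dF)
  qed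

  \<comment> \<open>The affine coordinates \<open>x\<close> as a global chart of the
    submanifold\<close>
  define L where "L = (\<lambda>x. legendre_point \<phi> (grad \<psi> x))"
  have L_in: "L x \<in> ?M" if "x \<in> X" for x
    unfolding L_def using M inv' that by blast
  \<comment> \<open>A point of the submanifold is recovered from \<open>x\<close> alone:
    \<open>p = grad \<psi> x\<close>, and \<open>p\<close> fixes \<open>z\<close>.\<close>
  have M_L: "fst q \<in> X \<and> q = L (fst q)" if "q \<in> ?M" for q
  proof -
    from that obtain p where "p \<in> P" "q = legendre_point \<phi> p"
      by (auto simp: legendre_submanifold_eq_image)
    then show ?thesis
      using grad_in inv by (simp add: L_def) (simp add: legendre_point_def inv)
  qed
  have fst_L: "fst (L x) = x" if "x \<in> X" for x
    using inv' that by (simp add: L_def legendre_point_def)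
  have vf_L: "contact_hamiltonian_vf h (L x) = (?d, g x *v ?d, grad \<psi> x \<bullet> ?d)" if "x \<in> X" for x
    using vf[OF inv'(1)[OF that]] F[OF inv'(1)[OF that]] inv'[OF that] by (simp add: L_def)
  \<comment> \<open>In the \<open>z\<close>-component the terms from varying \<open>p\<close>
    cancel, since \<open>grad \<phi>\<close> sends \<open>grad \<psi> x\<close> back to
    \<open>x\<close>. What remains is the Legendre condition: \<open>contact_form\<close> vanishes
    on these tangent vectors.\<close>
  have L_deriv: "(L has_derivative (\<lambda>u. (u, g x *v u, grad \<psi> x \<bullet> u))) (at x)" if "x \<in> X" for x
  proof -
    have "u v* hess \<psi> x = g x *v u" for u
      using g_hess[OF that] g_sym[OF that] by (metis vector_transpose_matrix)
    then have G: "(grad \<psi> has_derivative (\<lambda>u. g x *v u)) (at x)"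
      using has_derivative_grad[OF assms(9,3) that] by simp
    have "((\<lambda>x. \<phi> (grad \<psi> x)) has_derivative (\<lambda>u. x \<bullet> (g x *v u))) (at x)"
      using has_derivative_compose[OF G has_derivative_inner_grad[OF phi_diff[OF inv'(1)[OF that]]]]
      by (simp add: inv'[OF that])
    note [derivative_intros] = G this
    have "((\<lambda>x. (x, grad \<psi> x, x \<bullet> grad \<psi> x - \<phi> (grad \<psi> x))) has_derivative
        (\<lambda>u. (u, g x *v u, grad \<psi> x \<bullet> u))) (at x)"
      by (rule derivative_eq_intros G refl)+ (auto simp: inner_commute)
    then show ?thesis
    proof (rule has_derivative_transform_within_open[OF _ assms(3) that])
      fix y assume "y \<in> X"
      then show "(y, grad \<psi> y, y \<bullet> grad \<psi> y - \<phi> (grad \<psi> y)) = L y"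
        using inv' by (simp add: L_def legendre_point_def)
          (simp add: inner_vec_def grad_def vec_eq_iff mult.commute)
    qed
  qed

  \<comment> \<open>Integral curves as lifts of straight segments\<close>
  let ?I = "integral_curve_on {0..1} (?M \<inter> {q \<in> C. h q = 0}) (contact_hamiltonian_vf h)"
  let ?G = "geodesic_on {0..1} ?M nabla"
  let ?line = "\<lambda>t. x' + t *\<^sub>R ?d"
  \<comment> \<open>For \<open>u = ?d\<close> the derivative in \<open>L_deriv\<close> is the value
    in \<open>vf_L\<close>. Curves matter only on the unit interval, so \<open>\<gamma>\<close> need
    agree with the lifted line only there.\<close>
  have lift: "?I \<gamma>" if "\<And>t. t \<in> {0..1} \<Longrightarrow> ?line t \<in> X \<and> \<gamma> t = L (?line t)" for \<gamma>
    unfolding integral_curve_on_def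
  proof
    fix t :: real assume t: "t \<in> {0..1}"
    have "(?line has_derivative (\<lambda>s. s *\<^sub>R ?d)) (at t within {0..1})"
      by (auto intro!: derivative_eq_intros)
    from has_derivative_compose[OF this L_deriv] that[OF t]
    have "((\<lambda>t. L (?line t)) has_vector_derivative contact_hamiltonian_vf h (L (?line t)))
        (at t within {0..1})"
      by (simp add: has_vector_derivative_def vf_L matrix_vector_mult_scaleR)
    then have "(\<gamma> has_vector_derivative contact_hamiltonian_vf h (\<gamma> t)) (at t within {0..1})"
      using that t by (auto intro: has_vector_derivative_transform)
    moreover have "\<gamma> t \<in> ?M"
      using that[OF t] L_in by simp
    ultimately show "\<gamma> t \<in> ?M \<inter> {q \<in> C. h q = 0} \<and>
        (\<gamma> has_vector_derivative contact_hamiltonian_vf h (\<gamma> t)) (at t within {0..1})"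
      using sub by blast
  qed
  \<comment> \<open>This serves three times: for the position along integral curves, and for the
    velocity and position of geodesics.\<close>
  have affine: "f t = f 0 + t *\<^sub>R c"
    if "\<And>t. t \<in> {0..1} \<Longrightarrow> (f has_vector_derivative c) (at t within {0..1})" "t \<in> {0..1}"
    for f :: "real \<Rightarrow> real^'n" and c t
  proof -
    have "((\<lambda>t. f t - t *\<^sub>R c) has_derivative (\<lambda>h. 0)) (at t within {0..1})"
      if "t \<in> {0..1}" for t
      using \<open>\<And>t. t \<in> {0..1} \<Longrightarrow> _\<close>[OF that] unfolding has_vector_derivative_def
      by (auto intro!: derivative_eq_intros)
    then have "\<exists>a. \<forall>t\<in>{0..1}. f t - t *\<^sub>R c = a"
      by (intro has_derivative_zero_constant) auto
    then obtain a where a: "\<And>t. t \<in> {0..1} \<Longrightarrow> f t - t *\<^sub>R c = a"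
      by blast
    from a[of 0] a[OF that(2)] show ?thesis by (simp add: algebra_simps)
  qed
  have integral_deriv: "((\<lambda>t. fst (\<gamma> t)) has_vector_derivative ?d) (at t within {0..1})"
    if "?I \<gamma>" "t \<in> {0..1}" for \<gamma> t
  proof -
    have "\<gamma> t \<in> ?M"
      and deriv: "(\<gamma> has_vector_derivative contact_hamiltonian_vf h (\<gamma> t)) (at t within {0..1})"
      using that unfolding integral_curve_on_def by blast+
    then have "fst (contact_hamiltonian_vf h (\<gamma> t)) = ?d"
      using M_L[of "\<gamma> t"] vf_L[of "fst (\<gamma> t)"] by (metis fst_conv)
    then show ?thesis
      using bounded_linear.has_vector_derivative[OF bounded_linear_fst deriv] by simp
  qed
  have integral_line: "fst (\<gamma> t) = ?line t"
    if "?I \<gamma>" "fst (\<gamma> 0) = x'" "t \<in> {0..1}" for \<gamma> t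
    using affine[of "\<lambda>t. fst (\<gamma> t)" ?d t] integral_deriv that by simp

  \<comment> \<open>Integral curves and geodesics coincide\<close>
  have equiv: "?I \<gamma> \<and> fst (\<gamma> 0) = x' \<longleftrightarrow> ?G \<gamma> \<and> fst (\<gamma> 0) = x' \<and> fst (\<gamma> 1) = x''" for \<gamma>
  proof
    assume I: "?I \<gamma> \<and> fst (\<gamma> 0) = x'"
    then have M\<gamma>: "\<gamma> t \<in> ?M" if "t \<in> {0..1}" for t
      using that unfolding integral_curve_on_def by blast
    have "?G \<gamma>"
      unfolding geodesic_on_def
    proof (intro conjI exI ballI)
      fix t :: real assume t: "t \<in> {0..1}"
      show "\<gamma> t \<in> ?M" using M\<gamma> t .
      \<comment> \<open>The velocity and acceleration demanded by the geodesic equation are the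
        constant functions with values \<open>?d\<close> and 0.\<close>
      show "((\<lambda>s. fst (\<gamma> s)) has_vector_derivative (\<lambda>t. ?d) t) (at t within {0..1})"
        using integral_deriv I t by simp
      show "((\<lambda>t. ?d) has_vector_derivative (\<lambda>t. 0) t) (at t within {0..1})"
        by simp
      show "(\<lambda>t. 0) t + (\<Sum>a\<in>UNIV. \<Sum>b\<in>UNIV. (?d $ a * ?d $ b) *\<^sub>R nabla (fst (\<gamma> t)) a b) = 0"
        using flat M_L M\<gamma>[OF t] by simp
    qed
    then show "?G \<gamma> \<and> fst (\<gamma> 0) = x' \<and> fst (\<gamma> 1) = x''"
      using I integral_line[of \<gamma> 1] by simp
  next
    assume G: "?G \<gamma> \<and> fst (\<gamma> 0) = x' \<and> fst (\<gamma> 1) = x''"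
    then obtain v w where M\<gamma>: "\<And>t. t \<in> {0..1} \<Longrightarrow> \<gamma> t \<in> ?M"
      and v: "\<And>t. t \<in> {0..1} \<Longrightarrow>
        ((\<lambda>s. fst (\<gamma> s)) has_vector_derivative v t) (at t within {0..1})"
      and w: "\<And>t. t \<in> {0..1} \<Longrightarrow> (v has_vector_derivative w t) (at t within {0..1})"
      and eq: "\<And>t. t \<in> {0..1} \<Longrightarrow>
        w t + (\<Sum>a\<in>UNIV. \<Sum>b\<in>UNIV. (v t $ a * v t $ b) *\<^sub>R nabla (fst (\<gamma> t)) a b) = 0"
      unfolding geodesic_on_def by blast
    have "w t = 0" if "t \<in> {0..1}" for t
      using eq[OF that] M_L[OF M\<gamma>[OF that]] flat by simp
    then have v_const: "v t = v 0" if "t \<in> {0..1}" for t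
      using affine[of v 0 t] w that by simp
    have "((\<lambda>s. fst (\<gamma> s)) has_vector_derivative v 0) (at t within {0..1})"
      if "t \<in> {0..1}" for t
      using v[OF that] unfolding v_const[OF that] .
    then have line: "fst (\<gamma> t) = x' + t *\<^sub>R v 0" if "t \<in> {0..1}" for t
      using affine[of "\<lambda>t. fst (\<gamma> t)" "v 0" t] that G by simp
    \<comment> \<open>The endpoint condition at time 1 determines the constant velocity.\<close>
    from line[of 1] have "v 0 = ?d"
      using G by (simp add: algebra_simps)
    \<comment> \<open>Lying on the submanifold forces the whole geodesic, not just its
      \<open>x\<close>-part, to be the lift of the segment.\<close>
    then have "?line t \<in> X \<and> \<gamma> t = L (?line t)" if "t \<in> {0..1}" for t
      using line[OF that] M_L[OF M\<gamma>[OF that]] by simp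
    then show "?I \<gamma> \<and> fst (\<gamma> 0) = x'"
      using lift G by blast
  qed

  \<comment> \<open>Existence of the curve\<close>
  have segment: "closed_segment x' x'' = ?line ` {0..1}"
    unfolding closed_segment_image_interval by (rule image_cong) (simp_all add: algebra_simps)
  have ex: "(\<exists>\<gamma>. ?I \<gamma> \<and> fst (\<gamma> 0) = x') \<longleftrightarrow> closed_segment x' x'' \<subseteq> X"
  proof
    assume "\<exists>\<gamma>. ?I \<gamma> \<and> fst (\<gamma> 0) = x'"
    then obtain \<gamma> where \<gamma>: "?I \<gamma>" "fst (\<gamma> 0) = x'" by blast
    then have "?line t \<in> X" if "t \<in> {0..1}" for t
      using integral_line[OF \<gamma> that] M_L[of "\<gamma> t"] that unfolding integral_curve_on_def by auto
    then show "closed_segment x' x'' \<subseteq> X"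
      unfolding segment by blast
  next
    assume "closed_segment x' x'' \<subseteq> X"
    then have line: "?line t \<in> X" if "t \<in> {0..1}" for t
      using that unfolding segment by blast
    then have "?I (\<lambda>t. L (?line t))"
      by (intro lift) simp
    moreover have "fst (L (?line 0)) = x'"
      using line[of 0] fst_L by simp
    ultimately show "\<exists>\<gamma>. ?I \<gamma> \<and> fst (\<gamma> 0) = x'" by blast
  qed
  show ?thesis
    using sub components equiv ex by blast
qed

end
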